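(* For every integer $n\ge 1$, the number of inversion sequences of length $n$ avoiding the pattern $0012$ is $$|\mathbf{I}_n(0012)| = 1+\sum_{i=1}^{n-1}\binom{2i}{i-1}.$$
   Context: An inversion sequence of length $n$ is a sequence $e=e_1e_2\cdots e_n$ of integers with $0\le e_i\le i-1$ for each $1\le i\le n$. The reduction of a word with nonnegative integer entries is the word obtained by replacing each occurrence of the $k$-th smallest distinct entry by $k-1$. A sequence $e$ contains a pattern $p$ if some subsequence of $e$ (entries taken at increasing positions, not necessarily consecutive) has reduction equal to $p$; otherwise $e$ avoids $p$. $\mathbf{I}_n(0012)$ denotes the set of inversion sequences of length $n$ avoiding the pattern $0012$. *)

theory Defs
  imports Main "HOL-Library.Sublist"
begin

text \<open>
  Words are 0-indexed lists of naturals, so the bound \<open>0 \<le> e\<^sub>i \<le> i - 1\<close> on the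
  \<open>i\<close>-th entry (counting from 1) becomes \<open>e ! i \<le> i\<close>.
\<close>

definition inversion_sequences :: "nat \<Rightarrow> nat list set" where
  "inversion_sequences n = {e. length e = n \<and> (\<forall>i<n. e ! i \<le> i)}"

text \<open>
  An entry \<open>x\<close> is the \<open>k\<close>-th smallest distinct entry of \<open>w\<close> iff exactly \<open>k - 1\<close>
  distinct entries of \<open>w\<close> are smaller than \<open>x\<close>.
\<close>

definition reduction :: "nat list \<Rightarrow> nat list" where
  "reduction w = map (\<lambda>x. card {y \<in> set w. y < x}) w"

definition contains_pattern :: "nat list \<Rightarrow> nat list \<Rightarrow> bool" where
  "contains_pattern e p \<longleftrightarrow> (\<exists>w. subseq w e \<and> reduction w = p)"

definition avoiding_inversion_sequences :: "nat \<Rightarrow> nat list \<Rightarrow> nat list set" where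
  "avoiding_inversion_sequences n p =
     {e \<in> inversion_sequences n. \<not> contains_pattern e p}"

end

theory Submission
  imports Defs "HOL-Computational_Algebra.Formal_Power_Series"
begin

text \<open>
  Up to its first repeated entry an inversion sequence is forced to be \<open>0, 1, \<dots>, k - 1\<close>; it
  avoids 0012 iff the suffix starting with that repetition avoids 012. When a 012-avoiding word
  is read from left to right, only its minimum \<open>m\<close> so far and the smallest top \<open>M\<close> of an ascent so
  far matter, and each letter lowers one of the two while keeping \<open>m < M\<close>. Summing the counts
  over \<open>M\<close> turns this into a linear recursion with antisymmetric initial value, so (as in the
  reflection principle) the constraint disappears: with \<open>y\<close> marking \<open>M\<close> and \<open>z\<close> marking \<open>m\<close>,
  one letter is multiplication by \<open>H = 1/(1-y) + 1/(1-z)\<close>. The bound \<open>e ! i \<le> i\<close> amounts to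
  taking diagonal coefficients, that is, to multiplying \<open>H\<close> by \<open>y * z\<close>, and
  \<open>1 - y * z * H = (1 - y - z) * (1 - y * z) / ((1 - y) * (1 - z))\<close>. Here \<open>1 / (1 - y * z)\<close>
  produces the sum over \<open>i\<close>, and \<open>1 / (1 - y - z)\<close> the binomial coefficients.
\<close>

section \<open>From avoiding 0012 to avoiding 012\<close>

definition avoids_012 :: "nat list \<Rightarrow> bool" where
  "avoids_012 s \<longleftrightarrow> (\<forall>a b c. subseq [a, b, c] s \<longrightarrow> a < b \<longrightarrow> b < c \<longrightarrow> False)"

definition avoids_0012 :: "nat list \<Rightarrow> bool" where
  "avoids_0012 s \<longleftrightarrow> (\<forall>a b c. subseq [a, a, b, c] s \<longrightarrow> a < b \<longrightarrow> b < c \<longrightarrow> False)"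

text \<open>Here \<open>s\<close> is thought of as the part of an inversion sequence that starts at
  index \<open>p\<close>.\<close>

definition growth_bounded :: "nat \<Rightarrow> nat list \<Rightarrow> bool" where
  "growth_bounded p s \<longleftrightarrow> (\<forall>j<length s. s ! j \<le> p + j)"

text \<open>The rank \<open>rk\<close> is monotone, and strictly so above an entry of
  \<open>w\<close>; hence equal ranks force equal entries, and a smaller rank forces a smaller
  entry.\<close>

lemma reduction_eq_0012_iff:
  "reduction w = [0, 0, 1, 2] \<longleftrightarrow> (\<exists>a b c. w = [a, a, b, c] \<and> a < b \<and> b < c)"
proof
  define rk where "rk x = card {y \<in> set w. y < x}" for x
  assume red: "reduction w = [0, 0, 1, 2]"
  then have "length (reduction w) = 4"
    by simp
  then have "length w = 4"
    by (simp add: reduction_def)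
  then obtain p q b c where w: "w = [p, q, b, c]"
    by (auto simp: numeral_eq_Suc length_Suc_conv)
  have rk: "rk p = 0" "rk q = 0" "rk b = 1" "rk c = 2"
    using red unfolding reduction_def rk_def w by auto
  have mono: "rk x \<le> rk y" if "x \<le> y" for x y
    unfolding rk_def using that by (intro card_mono) auto
  have strict: "rk x < rk y" if "x < y" "x \<in> set w" for x y
    unfolding rk_def using that by (intro psubset_card_mono) auto
  have "p = q"
    using strict[of p q] strict[of q p] rk w by (cases p q rule: linorder_cases) auto
  moreover have "p < b" "b < c"
    using mono[of b p] mono[of c b] rk by linarith+
  ultimately show "\<exists>a b c. w = [a, a, b, c] \<and> a < b \<and> b < c"
    using w by blast
next
  assume "\<exists>a b c. w = [a, a, b, c] \<and> a < b \<and> b < c"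
  then obtain a b c where w: "w = [a, a, b, c]" "a < b" "b < c"
    by blast
  have "{y \<in> set w. y < a} = {}" "{y \<in> set w. y < b} = {a}" "{y \<in> set w. y < c} = {a, b}"
    using w by auto
  moreover have "reduction w = map (\<lambda>x. card {y \<in> set w. y < x}) [a, a, b, c]"
    by (simp add: reduction_def w(1))
  ultimately show "reduction w = [0, 0, 1, 2]"
    using w(2,3) by (simp only: list.map) simp
qed

lemma contains_0012_iff: "contains_pattern e [0, 0, 1, 2] \<longleftrightarrow> \<not> avoids_0012 e"
  unfolding contains_pattern_def avoids_0012_def reduction_eq_0012_iff by auto

lemma subseq_Cons_Cons_iff:
  "subseq (a # w) (x # s) \<longleftrightarrow> a = x \<and> subseq w s \<or> subseq (a # w) s"
  by (cases "a = x") (auto dest: subseq_Cons')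

lemma subseq_pair_Cons_iff:
  "subseq [b, c] (x # s) \<longleftrightarrow> b = x \<and> c \<in> set s \<or> subseq [b, c] s"
  by (simp only: subseq_Cons_Cons_iff[of b] subseq_singleton_left)

lemma avoids_012_Cons:
  "avoids_012 (x # s) \<longleftrightarrow>
     avoids_012 s \<and> (\<forall>b c. subseq [b, c] s \<longrightarrow> x < b \<longrightarrow> b < c \<longrightarrow> False)"
  unfolding avoids_012_def subseq_Cons_Cons_iff[of _ _ x] by blast

text \<open>A 012 that starts with \<open>m\<close> cannot use \<open>x\<close>, and it stays a 012
  when \<open>m\<close> is replaced by \<open>x\<close>; so \<open>m\<close> can be
  forgotten.\<close>

lemma avoids_012_Cons_Cons_le:
  assumes "x \<le> m"
  shows "avoids_012 (m # x # s) \<longleftrightarrow> avoids_012 (x # s)"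
  using assms unfolding avoids_012_Cons subseq_pair_Cons_iff
  by (meson le_less_trans leD)

text \<open>The ascent from \<open>m\<close> to \<open>x\<close> caps all later letters at
  \<open>x\<close>; under this cap, \<open>x\<close> is neither the first nor the middle letter of a
  012.\<close>

lemma avoids_012_Cons_Cons_less:
  assumes "m < x"
  shows "avoids_012 (m # x # s) \<longleftrightarrow> avoids_012 (m # s) \<and> (\<forall>c\<in>set s. c \<le> x)"
proof -
  have mem: "c \<in> set s" if "subseq [b, c] s" for b c
    using subseq_Cons'[OF that] by (simp add: subseq_singleton_left)
  show ?thesis
  proof
    assume "avoids_012 (m # x # s)"
    then show "avoids_012 (m # s) \<and> (\<forall>c\<in>set s. c \<le> x)"
      using assms unfolding avoids_012_Cons subseq_pair_Cons_iff by (blast intro: leI)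
  next
    assume R: "avoids_012 (m # s) \<and> (\<forall>c\<in>set s. c \<le> x)"
    then have "\<not> x < c" if "c \<in> set s" for c
      using that by (simp add: not_less)
    then show "avoids_012 (m # x # s)"
      using R mem unfolding avoids_012_Cons subseq_pair_Cons_iff by (blast dest: less_trans)
  qed
qed

text \<open>The second \<open>a\<close> cannot lie in the distinct \<open>xs\<close>, so it and all
  that follows it lie in \<open>ys\<close>.\<close>

lemma subseq_drop_distinct_prefix:
  assumes "distinct xs" "subseq (a # a # w) (xs @ ys)"
  shows "subseq (a # w) ys"
  using assms
proof (induction xs)
  case Nil
  then show ?case using subseq_Cons' by simp
next
  case (Cons x xs)
  have skip: "subseq (a # w) ys" if "a \<notin> set zs" "subseq (a # w) (zs @ ys)" for zs
    using that by (induction zs) simp_all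
  from Cons.prems consider "x = a" "subseq (a # w) (xs @ ys)" | "subseq (a # a # w) (xs @ ys)"
    unfolding append_Cons subseq_Cons_Cons_iff[of _ _ x] by blast
  then show ?case
    using Cons.IH Cons.prems(1) skip[of xs] by cases simp_all
qed

text \<open>If \<open>a < p\<close>, the prefix supplies a second \<open>a\<close> in front of any
  012 that starts with \<open>a\<close>. If \<open>p \<le> a\<close>, then \<open>x < p\<close> can
  take the place of \<open>a\<close>, which leads back to the first case.\<close>

lemma avoids_0012_upt_append:
  assumes "x < p"
  shows "avoids_0012 ([0..<p] @ x # s) \<longleftrightarrow> avoids_012 (x # s)"
proof
  assume L: "avoids_0012 ([0..<p] @ x # s)"
  have rep: False if "a < p" "subseq [a, b, c] (x # s)" "a < b" "b < c" for a b c
  proof -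
    have "subseq ([a] @ [a, b, c]) ([0..<p] @ x # s)"
      using that by (intro list_emb_append_mono) (auto simp: subseq_singleton_left)
    then have "subseq [a, a, b, c] ([0..<p] @ x # s)"
      by (simp only: append.simps)
    then show False
      using L that(3,4) unfolding avoids_0012_def by blast
  qed
  show "avoids_012 (x # s)"
    unfolding avoids_012_def
  proof (intro allI impI)
    fix a b c :: nat
    assume *: "subseq [a, b, c] (x # s)" "a < b" "b < c"
    show False
    proof (cases "a < p")
      case True
      then show False using rep * by blast
    next
      case False
      have "subseq [b, c] s"
        using *(1) subseq_Cons'[of a "[b, c]" s] unfolding subseq_Cons_Cons_iff[of a] by blast
      then have "subseq [x, b, c] (x # s)"
        by simp
      then show False
        using rep[of x b c] * False assms by simp
    qed
  qed
next
  assume avoids: "avoids_012 (x # s)"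
  show "avoids_0012 ([0..<p] @ x # s)"
    unfolding avoids_0012_def
  proof (intro allI impI)
    fix a b c
    assume "subseq [a, a, b, c] ([0..<p] @ x # s)" "a < b" "b < c"
    then show False
      using subseq_drop_distinct_prefix[OF distinct_upt, of a "[b, c]" 0 p "x # s"] avoids
      unfolding avoids_012_def by blast
  qed
qed

section \<open>Counting words letter by letter\<close>

lemma growth_bounded_Cons: "growth_bounded p (x # s) \<longleftrightarrow> x \<le> p \<and> growth_bounded (Suc p) s"
  unfolding growth_bounded_def by (auto simp: less_Suc_eq_0_disj nth_Cons split: nat.splits)

lemma growth_bounded_le: "growth_bounded p s \<Longrightarrow> c \<in> set s \<Longrightarrow> c \<le> p + length s"
  unfolding growth_bounded_def by (auto simp: in_set_conv_nth)

lemma growth_bounded_if_le: "\<forall>c\<in>set s. c \<le> p \<Longrightarrow> growth_bounded p s"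
  unfolding growth_bounded_def by (meson nth_mem trans_le_add1)

lemma card_words_Suc:
  assumes "finite A" "\<And>x s. P (x # s) \<Longrightarrow> x \<in> A"
    and "\<And>x. finite {s. length s = r \<and> P (x # s)}"
  shows "card {s. length s = Suc r \<and> P s} = (\<Sum>x\<in>A. card {s. length s = r \<and> P (x # s)})"
proof -
  have "bij_betw (\<lambda>(x, s). x # s) (SIGMA x:A. {s. length s = r \<and> P (x # s)})
          {s. length s = Suc r \<and> P s}"
    using assms(2) by (auto simp: bij_betw_def inj_on_def length_Suc_conv image_iff)
  then have "card {s. length s = Suc r \<and> P s} = card (SIGMA x:A. {s. length s = r \<and> P (x # s)})"
    by (simp add: bij_betw_same_card)
  then show ?thesis
    using assms(1,3) by (simp add: card_SigmaI)
qed

lemma finite_words_bounded: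
  fixes B :: nat
  assumes "\<And>s c. length s = r \<Longrightarrow> P s \<Longrightarrow> c \<in> set s \<Longrightarrow> c \<le> B"
  shows "finite {s. length s = r \<and> P s}"
  by (rule finite_subset[OF _ finite_lists_length_eq[of "{..B}" r]]) (use assms in auto)

text \<open>The three counts belong to three phases of reading, with \<open>r\<close> letters to
  come. In \<open>capped_count\<close> an ascent has occurred, \<open>m\<close> is the least letter
  so far and \<open>M\<close> the smallest ascent top; in \<open>growing_count\<close> a repetition
  has occurred but no ascent since; in \<open>staircase_count\<close> there is no repetition
  yet.\<close>

definition capped_count :: "nat \<Rightarrow> nat \<Rightarrow> nat \<Rightarrow> nat" where
  "capped_count r m M = card {s. length s = r \<and> (\<forall>c\<in>set s. c \<le> M) \<and> avoids_012 (m # s)}"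

definition growing_count :: "nat \<Rightarrow> nat \<Rightarrow> nat \<Rightarrow> nat" where
  "growing_count r m p = card {s. length s = r \<and> growth_bounded p s \<and> avoids_012 (m # s)}"

definition staircase_count :: "nat \<Rightarrow> nat \<Rightarrow> nat" where
  "staircase_count r p = card {s. length s = r \<and> growth_bounded p s \<and> avoids_0012 ([0..<p] @ s)}"

lemma capped_count_0 [simp]: "capped_count 0 m M = 1"
proof -
  have "{s. length s = 0 \<and> (\<forall>c\<in>set s. c \<le> M) \<and> avoids_012 (m # s)} = {[]}"
    by (auto simp: avoids_012_def split: if_splits)
  then show ?thesis by (simp add: capped_count_def)
qed

lemma growing_count_0 [simp]: "growing_count 0 m M = 1"
proof -
  have "{s. length s = 0 \<and> growth_bounded M s \<and> avoids_012 (m # s)} = {[]}"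
    by (auto simp: avoids_012_def growth_bounded_def split: if_splits)
  then show ?thesis by (simp add: growing_count_def)
qed

lemma staircase_count_0 [simp]: "staircase_count 0 p = 1"
proof -
  have "avoids_0012 [0..<p]"
    unfolding avoids_0012_def
  proof (intro allI impI)
    fix a b c
    assume "subseq [a, a, b, c] [0..<p]"
    then have "subseq [a, b, c] []"
      using subseq_drop_distinct_prefix[of "[0..<p]" a "[b, c]" "[]"] by simp
    then show False by simp
  qed
  then have "{s. length s = 0 \<and> growth_bounded p s \<and> avoids_0012 ([0..<p] @ s)} = {[]}"
    by (auto simp: growth_bounded_def)
  then show ?thesis by (simp add: staircase_count_def)
qed

lemma capped_count_Suc:
  assumes "m \<le> M"
  shows "capped_count (Suc r) m M =
           (\<Sum>x\<le>m. capped_count r x M) + (\<Sum>x\<in>{m<..M}. capped_count r m x)"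
proof -
  let ?P = "\<lambda>s. (\<forall>c\<in>set s. c \<le> M) \<and> avoids_012 (m # s)"
  have "capped_count (Suc r) m M = (\<Sum>x\<in>{..m} \<union> {m<..M}. card {s. length s = r \<and> ?P (x # s)})"
    unfolding capped_count_def
  proof (rule card_words_Suc)
    show "finite {s. length s = r \<and> ?P (x # s)}" for x
      by (rule finite_words_bounded[where B = M]) auto
  qed auto
  also have "\<dots> = (\<Sum>x\<le>m. card {s. length s = r \<and> ?P (x # s)})
                + (\<Sum>x\<in>{m<..M}. card {s. length s = r \<and> ?P (x # s)})"
    by (intro sum.union_disjoint) auto
  also have "(\<Sum>x\<le>m. card {s. length s = r \<and> ?P (x # s)}) = (\<Sum>x\<le>m. capped_count r x M)"
    unfolding capped_count_def using assms
    by (intro sum.cong arg_cong[where f = card] refl) (auto simp: avoids_012_Cons_Cons_le)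
  also have "(\<Sum>x\<in>{m<..M}. card {s. length s = r \<and> ?P (x # s)}) = (\<Sum>x\<in>{m<..M}. capped_count r m x)"
    unfolding capped_count_def
    by (intro sum.cong arg_cong[where f = card] refl) (auto simp: avoids_012_Cons_Cons_less)
  finally show ?thesis .
qed

lemma growing_count_Suc:
  assumes "m \<le> p"
  shows "growing_count (Suc r) m p =
           (\<Sum>x\<le>m. growing_count r x (Suc p)) + (\<Sum>x\<in>{m<..p}. capped_count r m x)"
proof -
  let ?P = "\<lambda>s. growth_bounded p s \<and> avoids_012 (m # s)"
  have "growing_count (Suc r) m p = (\<Sum>x\<in>{..m} \<union> {m<..p}. card {s. length s = r \<and> ?P (x # s)})"
    unfolding growing_count_def
  proof (rule card_words_Suc)
    show "finite {s. length s = r \<and> ?P (x # s)}" for x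
      by (rule finite_words_bounded[where B = "Suc p + r"])
        (use growth_bounded_le[of "Suc p"] in \<open>auto simp: growth_bounded_Cons\<close>)
  qed (auto simp: growth_bounded_Cons)
  also have "\<dots> = (\<Sum>x\<le>m. card {s. length s = r \<and> ?P (x # s)})
                + (\<Sum>x\<in>{m<..p}. card {s. length s = r \<and> ?P (x # s)})"
    by (intro sum.union_disjoint) auto
  also have "(\<Sum>x\<le>m. card {s. length s = r \<and> ?P (x # s)}) = (\<Sum>x\<le>m. growing_count r x (Suc p))"
    unfolding growing_count_def using assms
    by (intro sum.cong arg_cong[where f = card] refl)
      (auto simp: avoids_012_Cons_Cons_le growth_bounded_Cons)
  also have "(\<Sum>x\<in>{m<..p}. card {s. length s = r \<and> ?P (x # s)}) = (\<Sum>x\<in>{m<..p}. capped_count r m x)"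
    unfolding capped_count_def
  proof (intro sum.cong arg_cong[where f = card] refl Collect_cong)
    fix x s
    assume x: "x \<in> {m<..p}"
    \<comment> \<open>Since the cap \<open>x\<close> is at most \<open>p\<close>, the growth bound
      holds by itself from the first ascent on.\<close>
    then have "growth_bounded (Suc p) s" if "\<forall>c\<in>set s. c \<le> x"
      using that by (intro growth_bounded_if_le) force
    then show "(length s = r \<and> ?P (x # s)) =
        (length s = r \<and> (\<forall>c\<in>set s. c \<le> x) \<and> avoids_012 (m # s))"
      using x by (auto simp: avoids_012_Cons_Cons_less growth_bounded_Cons)
  qed
  finally show ?thesis .
qed

text \<open>The letter \<open>p\<close> prolongs the prefix to \<open>[0..<Suc p]\<close>; any
  smaller letter is the first repetition.\<close>

lemma staircase_count_Suc:
  "staircase_count (Suc r) p = staircase_count r (Suc p) + (\<Sum>x<p. growing_count r x (Suc p))"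
proof -
  let ?P = "\<lambda>s. growth_bounded p s \<and> avoids_0012 ([0..<p] @ s)"
  have "staircase_count (Suc r) p = (\<Sum>x\<in>insert p {..<p}. card {s. length s = r \<and> ?P (x # s)})"
    unfolding staircase_count_def
  proof (rule card_words_Suc)
    show "finite {s. length s = r \<and> ?P (x # s)}" for x
      by (rule finite_words_bounded[where B = "Suc p + r"])
        (use growth_bounded_le[of "Suc p"] in \<open>auto simp: growth_bounded_Cons\<close>)
  qed (auto simp: growth_bounded_Cons)
  also have "\<dots> = card {s. length s = r \<and> ?P (p # s)}
                + (\<Sum>x<p. card {s. length s = r \<and> ?P (x # s)})"
    by simp
  also have "card {s. length s = r \<and> ?P (p # s)} = staircase_count r (Suc p)"
    by (simp add: staircase_count_def growth_bounded_Cons)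
  also have "(\<Sum>x<p. card {s. length s = r \<and> ?P (x # s)}) = (\<Sum>x<p. growing_count r x (Suc p))"
    unfolding growing_count_def
    by (intro sum.cong arg_cong[where f = card] refl)
      (auto simp: avoids_0012_upt_append growth_bounded_Cons)
  finally show ?thesis .
qed

lemma card_avoiding_0012: "card (avoiding_inversion_sequences n [0, 0, 1, 2]) = staircase_count n 0"
  unfolding avoiding_inversion_sequences_def inversion_sequences_def staircase_count_def
    contains_0012_iff growth_bounded_def
  by (intro arg_cong[where f = card]) auto

section \<open>Power series and the unconstrained recursion\<close>

unbundle fps_syntax

definition geo :: "'a::comm_ring_1 \<Rightarrow> 'a fps" where
  "geo c = Abs_fps (\<lambda>n. c ^ n)"

lemma geo_nth [simp]: "geo c $ n = c ^ n"
  by (simp add: geo_def)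

lemma geo_inverse: "(1 - fps_const c * fps_X) * geo c = 1"
proof (rule fps_ext)
  fix n
  show "((1 - fps_const c * fps_X) * geo c) $ n = 1 $ n"
    by (cases n) (simp_all add: algebra_simps)
qed

lemma geo_1_mult_nth: "(geo 1 * f) $ n = (\<Sum>k\<le>n. f $ k)"
  by (simp add: fps_mult_nth mult.commute[of "geo 1"] atLeast0AtMost)

text \<open>Series in two variables are nested: \<open>f $ M $ m\<close> is the coefficient of
  \<open>y^M z^m\<close>, with \<open>y\<close> the outer and \<open>z\<close> the inner variable.
  \<open>IY\<close> and \<open>IZ\<close> are \<open>1/(1-y)\<close> and
  \<open>1/(1-z)\<close>.\<close>

abbreviation Y :: "int fps fps" where "Y \<equiv> fps_X"
abbreviation Z :: "int fps fps" where "Z \<equiv> fps_const fps_X"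
abbreviation IY :: "int fps fps" where "IY \<equiv> geo 1"
abbreviation IZ :: "int fps fps" where "IZ \<equiv> fps_const (geo 1)"

text \<open>
  The coefficient of \<open>y^M z^m\<close> in \<open>ladder 0\<close> is \<open>M - m\<close>, the number of \<open>x\<close> with \<open>m < x \<le> M\<close>.
\<close>

definition ladder :: "nat \<Rightarrow> int fps fps" where
  "ladder r = (IY + IZ) ^ r * (IY * IZ * (IY - IZ))"

lemma IY_mult_nth: "(IY * f) $ M $ m = (\<Sum>k\<le>M. f $ k $ m)"
  by (simp add: geo_1_mult_nth fps_sum_nth)

lemma IZ_mult_nth: "(IZ * f) $ M $ m = (\<Sum>k\<le>m. f $ M $ k)"
  by (simp add: geo_1_mult_nth)

lemma ladder_0_nth: "ladder 0 $ M $ m = int M - int m"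
proof -
  have "ladder 0 = IY * (IZ * IY) - IZ * (IZ * IY)"
    by (simp add: ladder_def algebra_simps)
  then show ?thesis
    by (simp only: fps_sub_nth IY_mult_nth IZ_mult_nth) simp
qed

lemma ladder_Suc_nth: "ladder (Suc r) $ M $ m = (\<Sum>k\<le>M. ladder r $ k $ m) + (\<Sum>k\<le>m. ladder r $ M $ k)"
proof -
  have "ladder (Suc r) = IY * ladder r + IZ * ladder r"
    by (simp add: ladder_def algebra_simps)
  then show ?thesis
    by (simp only: fps_add_nth IY_mult_nth IZ_mult_nth)
qed

text \<open>Exchanging \<open>y\<close> and \<open>z\<close> fixes \<open>IY + IZ\<close> and
  \<open>IY * IZ\<close> and negates \<open>IY - IZ\<close>.\<close>

lemma ladder_antisym: "ladder r $ m $ M = - (ladder r $ M $ m)"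
proof (induction r arbitrary: m M)
  case 0
  then show ?case by (simp add: ladder_0_nth)
next
  case (Suc r)
  have "(\<Sum>k\<le>m. ladder r $ k $ M) = - (\<Sum>k\<le>m. ladder r $ M $ k)"
    unfolding sum_negf[symmetric] by (rule sum.cong[OF refl Suc.IH])
  moreover have "(\<Sum>k\<le>M. ladder r $ m $ k) = - (\<Sum>k\<le>M. ladder r $ k $ m)"
    unfolding sum_negf[symmetric] by (rule sum.cong[OF refl Suc.IH])
  ultimately show ?case
    by (simp add: ladder_Suc_nth)
qed

text \<open>
  The recursion of \<open>capped_count\<close> restricts \<open>x\<close> to \<open>m < x\<close>, that of \<open>ladder\<close> does not; the two
  surplus terms cancel by antisymmetry.
\<close>

lemma sum_capped_count:
  assumes "m \<le> M"
  shows "(\<Sum>x\<in>{m<..M}. int (capped_count r m x)) = ladder r $ M $ m"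
  using assms
proof (induction r arbitrary: m M)
  case 0
  then show ?case by (simp add: ladder_0_nth of_nat_diff)
next
  case (Suc r)
  have split: "(\<Sum>x\<in>{m<..M}. f x) = (\<Sum>x\<le>M. f x) - (\<Sum>x\<le>m. f x)" for f :: "nat \<Rightarrow> int"
  proof -
    have "{..M} = {..m} \<union> {m<..M}" using Suc.prems by auto
    then show ?thesis by (simp add: sum.union_disjoint ivl_disj_int)
  qed
  \<comment> \<open>The induction hypothesis covers only ranges that start just above
    \<open>y\<close>; the range above \<open>m\<close> is the difference of two of them.\<close>
  have above: "(\<Sum>x\<in>{m<..M}. int (capped_count r y x)) = ladder r $ M $ y - ladder r $ m $ y"
    if "y \<le> m" for y
  proof -
    have "{y<..M} = {y<..m} \<union> {m<..M}" using Suc.prems that by auto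
    then have "(\<Sum>x\<in>{y<..M}. int (capped_count r y x)) =
        (\<Sum>x\<in>{y<..m}. int (capped_count r y x)) + (\<Sum>x\<in>{m<..M}. int (capped_count r y x))"
      by (simp add: sum.union_disjoint ivl_disj_int)
    then show ?thesis using Suc.IH[of y m] Suc.IH[of y M] that Suc.prems by simp
  qed
  have "(\<Sum>x\<in>{m<..M}. int (capped_count (Suc r) m x))
      = (\<Sum>x\<in>{m<..M}. (\<Sum>y\<le>m. int (capped_count r y x)) + ladder r $ x $ m)"
    using Suc.IH by (intro sum.cong) (auto simp: capped_count_Suc)
  also have "\<dots> = (\<Sum>y\<le>m. \<Sum>x\<in>{m<..M}. int (capped_count r y x)) + (\<Sum>x\<in>{m<..M}. ladder r $ x $ m)"
    by (simp add: sum.distrib sum.swap[of _ "{m<..M}"])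
  also have "\<dots> = (\<Sum>y\<le>m. ladder r $ M $ y) - (\<Sum>y\<le>m. ladder r $ m $ y)
                + ((\<Sum>x\<le>M. ladder r $ x $ m) - (\<Sum>x\<le>m. ladder r $ x $ m))"
    by (simp add: above split[of "\<lambda>x. ladder r $ x $ m"] sum_subtractf cong: sum.cong_simp)
  also have "(\<Sum>y\<le>m. ladder r $ m $ y) = - (\<Sum>x\<le>m. ladder r $ x $ m)"
    unfolding sum_negf[symmetric] by (intro sum.cong refl ladder_antisym)
  finally show ?case by (simp add: ladder_Suc_nth)
qed

section \<open>Series for the growing and the staircase phase\<close>

text \<open>The recursion of \<open>growing_count\<close>, unrolled. The first summand counts words
  without an ascent; in the others, \<open>i\<close> letters follow the first ascent top, and each
  of the \<open>r - 1 - i\<close> letters before it contributes a factor \<open>geo 1\<close> and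
  raises \<open>p\<close> by one.\<close>

definition growing_gf :: "nat \<Rightarrow> nat \<Rightarrow> int fps" where
  "growing_gf r p = geo 1 ^ Suc r + (\<Sum>i<r. geo 1 ^ (r - 1 - i) * ladder i $ (p + (r - 1 - i)))"

lemma growing_gf_Suc: "growing_gf (Suc r) p = geo 1 * growing_gf r (Suc p) + ladder r $ p"
proof -
  have "geo 1 * (\<Sum>i<r. geo 1 ^ (r - 1 - i) * ladder i $ (Suc p + (r - 1 - i)))
      = (\<Sum>i<r. geo 1 ^ (r - i) * ladder i $ (p + (r - i)))"
    unfolding sum_distrib_left
  proof (intro sum.cong refl)
    fix i assume "i \<in> {..<r}"
    then have "r - i = Suc (r - 1 - i)" by auto
    then show "geo 1 * (geo 1 ^ (r - 1 - i) * ladder i $ (Suc p + (r - 1 - i)))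
      = geo 1 ^ (r - i) * ladder i $ (p + (r - i))"
      by (simp add: mult.assoc)
  qed
  then show ?thesis
    by (simp add: growing_gf_def distrib_left)
qed

lemma growing_count_gf: "m \<le> p \<Longrightarrow> int (growing_count r m p) = growing_gf r p $ m"
proof (induction r arbitrary: m p)
  case 0
  then show ?case by (simp add: growing_gf_def)
next
  case (Suc r)
  then show ?case
    by (simp add: growing_count_Suc growing_gf_Suc geo_1_mult_nth sum_capped_count[symmetric])
qed

text \<open>The 1 counts the word without repetition. In term \<open>j\<close> the staircase has
  reached \<open>p + j\<close> when a letter below \<open>p + j\<close> repeats an entry;
  \<open>fps_X\<close> makes the partial sum taken by \<open>geo 1\<close> strict.\<close>

lemma staircase_count_sum:
  "int (staircase_count r p) =
     1 + (\<Sum>j<r. (fps_X * (geo 1 * growing_gf (r - 1 - j) (Suc (p + j)))) $ (p + j))"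
proof (induction r arbitrary: p)
  case 0
  then show ?case by simp
next
  case (Suc r)
  have "(\<Sum>x<p. int (growing_count r x (Suc p))) = (\<Sum>x<p. growing_gf r (Suc p) $ x)"
    by (intro sum.cong) (auto simp: growing_count_gf)
  also have "\<dots> = (fps_X * (geo 1 * growing_gf r (Suc p))) $ p"
    by (cases p) (simp_all add: geo_1_mult_nth lessThan_Suc_atMost)
  finally show ?case
    by (simp add: staircase_count_Suc Suc.IH sum.lessThan_Suc_shift
        del: sum.lessThan_Suc fps_X_mult_nth)
qed

text \<open>With \<open>k = a - j\<close>, the left side is the coefficient of \<open>z^a\<close> in
  \<open>z * (z/(1-z))^k * f\<close>, summed over \<open>k\<close> from 1 to \<open>a\<close>.
  Larger \<open>k\<close> contribute nothing, and the full geometric series gives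
  \<open>z^2/(1-2*z)\<close>.\<close>

lemma sum_diagonal_powers:
  fixes f :: "int fps"
  shows "(\<Sum>j<a. (fps_X * (geo 1 ^ (a - j) * f)) $ j) = (fps_X ^ 2 * geo 2 * f) $ a"
proof (induction a arbitrary: f)
  case 0
  then show ?case by (simp add: power2_eq_square mult.assoc)
next
  case (Suc a)
  have D: "geo 1 * (1 + fps_X * geo 2) = (geo 2 :: int fps)"
  proof -
    have "(1 - fps_X) * geo 1 = (1 :: int fps)" "(1 - 2 * fps_X) * geo 2 = (1 :: int fps)"
      using geo_inverse[of "1::int"] geo_inverse[of "2::int"] by (simp_all add: numeral_fps_const)
    then show ?thesis by algebra
  qed
  have "(\<Sum>j<Suc a. (fps_X * (geo 1 ^ (Suc a - j) * f)) $ j)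
      = (\<Sum>j<a. (fps_X * (geo 1 ^ (a - j) * (geo 1 * f))) $ j) + (fps_X * (geo 1 * f)) $ a"
    by (simp add: Suc_diff_le algebra_simps)
  also have "\<dots> = (fps_X * (fps_X ^ 2 * geo 2 * (geo 1 * f)) + fps_X * (fps_X * (geo 1 * f))) $ Suc a"
    by (subst Suc.IH) simp
  also have "fps_X * (fps_X ^ 2 * geo 2 * (geo 1 * f)) + fps_X * (fps_X * (geo 1 * f))
      = fps_X ^ 2 * (geo 1 * (1 + fps_X * geo 2)) * f"
    by (simp add: algebra_simps power2_eq_square)
  finally show ?case by (simp add: D)
qed

text \<open>The row \<open>n - 1 - i\<close> of \<open>ladder i\<close> is the index of the first
  ascent top after the repetition and does not depend on the index \<open>j\<close> of the
  repetition. So the sums are interchanged and \<open>sum_diagonal_powers\<close> removes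
  \<open>j\<close>.\<close>

lemma staircase_count_gf:
  "int (staircase_count n 0) = 1 + (fps_X ^ 2 * geo 2 * geo 1) $ n
     + (\<Sum>i<n. (fps_X ^ 2 * geo 2 * ladder i $ (n - 1 - i)) $ (n - 1 - i))"
proof -
  let ?t = "\<lambda>i j. (fps_X * (geo 1 ^ (n - 1 - i - j) * ladder i $ (n - 1 - i))) $ j"
  have "(fps_X * (geo 1 * growing_gf (n - 1 - j) (Suc j))) $ j
      = (fps_X * (geo 1 ^ (n - j) * geo 1)) $ j + (\<Sum>i<n - 1 - j. ?t i j)" if "j < n" for j
  proof -
    have "n - j = Suc (n - 1 - j)" using that by simp
    then have "fps_X * (geo 1 * growing_gf (n - 1 - j) (Suc j))
        = fps_X * (geo 1 ^ (n - j) * geo 1)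
          + (\<Sum>i<n - 1 - j. fps_X * (geo 1 ^ Suc (n - 1 - j - 1 - i) * ladder i $ (Suc j + (n - 1 - j - 1 - i))))"
      by (simp add: growing_gf_def algebra_simps sum_distrib_left)
    also have "(\<Sum>i<n - 1 - j. fps_X * (geo 1 ^ Suc (n - 1 - j - 1 - i) * ladder i $ (Suc j + (n - 1 - j - 1 - i))))
        = (\<Sum>i<n - 1 - j. fps_X * (geo 1 ^ (n - 1 - i - j) * ladder i $ (n - 1 - i)))"
    proof (intro sum.cong refl)
      fix i assume "i \<in> {..<n - 1 - j}"
      then have "Suc (n - 1 - j - 1 - i) = n - 1 - i - j" "Suc j + (n - 1 - j - 1 - i) = n - 1 - i"
        by auto
      then show "fps_X * (geo 1 ^ Suc (n - 1 - j - 1 - i) * ladder i $ (Suc j + (n - 1 - j - 1 - i)))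
        = fps_X * (geo 1 ^ (n - 1 - i - j) * ladder i $ (n - 1 - i))" by simp
    qed
    finally show ?thesis by (simp add: fps_sum_nth)
  qed
  then have "int (staircase_count n 0) = 1 + (\<Sum>j<n. (fps_X * (geo 1 ^ (n - j) * geo 1)) $ j)
      + (\<Sum>j<n. \<Sum>i<n - 1 - j. ?t i j)"
    by (simp add: staircase_count_sum sum.distrib)
  also have "(\<Sum>j<n. \<Sum>i<n - 1 - j. ?t i j) = (\<Sum>i<n. \<Sum>j<n - 1 - i. ?t i j)"
    unfolding sum.Sigma[OF finite_lessThan ballI[OF finite_lessThan]]
    by (rule sum.reindex_bij_witness[of _ "\<lambda>(i, j). (j, i)" "\<lambda>(i, j). (j, i)"]) auto
  finally show ?thesis
    by (simp only: sum_diagonal_powers)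
qed

section \<open>Closed form and diagonal coefficients\<close>

definition binom_gf :: "int fps fps" where
  "binom_gf = Abs_fps (\<lambda>M. Abs_fps (\<lambda>m. int ((M + m + 2) choose (M + 1)) - 1))"

text \<open>This is Pascal's rule: subtracting 1 makes the formula vanish at \<open>M = -1\<close>
  and at \<open>m = -1\<close>, and leaves an excess of 1 at every coefficient.\<close>

lemma binom_gf_eq: "(1 - Y - Z) * binom_gf = IY * IZ"
proof (intro fps_ext)
  fix M m
  show "((1 - Y - Z) * binom_gf) $ M $ m = (IY * IZ) $ M $ m"
    by (cases M; cases m) (simp_all add: binom_gf_def binomial_eq_0 algebra_simps)
qed

text \<open>The factor \<open>geo fps_X\<close> is \<open>1 / (1 - y * z)\<close>.\<close>

definition total_gf :: "int fps fps" where
  "total_gf = (binom_gf - IY * IZ * fps_const (geo 2)) * geo fps_X"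

text \<open>A division-free form of the partial fractions
  \<open>(y-z)/((1-2*z)*(1-y-z)) = 1/(1-y-z) - 1/(1-2*z)\<close>, using
  \<open>a - b = a*b*(y-z)\<close>.\<close>

lemma kernel_identity:
  fixes y z a b d e p :: "'a::comm_ring_1"
  assumes a: "(1 - y) * a = 1" and b: "(1 - z) * b = 1" and d: "(1 - 2 * z) * d = 1"
    and e: "(1 - z * y) * e = 1" and p: "(1 - y - z) * p = a * b"
  shows "d * (a * b * (a - b)) = (p - a * b * d) * e * (1 - y * z * (a + b))"
proof -
  \<comment> \<open>Factors equal to 1 are inserted so that \<open>a * b\<close> can be pulled out
    of every term.\<close>
  have "1 - y * z * (a + b) = ((1 - y) * a) * ((1 - z) * b) - y * z * (b * ((1 - y) * a) + a * ((1 - z) * b))"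
    by (simp only: a b) (simp add: add.commute)
  also have "\<dots> = a * b * ((1 - y - z) * (1 - z * y))"
    by (simp add: algebra_simps)
  finally have "(p - a * b * d) * e * (1 - y * z * (a + b))
      = a * b * (((1 - y - z) * p) - a * b * d * (1 - y - z)) * ((1 - z * y) * e)"
    by (simp only:) (simp add: algebra_simps)
  also have "\<dots> = a * b * (a * b * ((1 - 2 * z) * d) - a * b * d * (1 - y - z))"
    by (simp only: p e d) simp
  also have "\<dots> = d * (a * b * (a * b * (y - z)))"
    by (simp add: algebra_simps)
  also have "a * b * (y - z) = a * ((1 - z) * b) - b * ((1 - y) * a)"
    by (simp add: algebra_simps)
  finally show ?thesis
    by (simp add: a b)
qed

lemma total_gf_eq:
  "fps_const (geo 2) * ladder 0 = total_gf * (1 - Y * Z * (IY + IZ))"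
proof -
  define D where "D = fps_const (geo 2 :: int fps)"
  have D: "(1 - 2 * Z) * D = 1"
    using arg_cong[OF geo_inverse[of "2::int"], of fps_const]
    by (simp add: D_def numeral_fps_const flip: fps_const_mult fps_const_sub)
  have Z: "(1 - Z) * IZ = 1"
    using arg_cong[OF geo_inverse[of "1::int"], of fps_const]
    by (simp flip: fps_const_mult fps_const_sub)
  have Y: "(1 - Y) * IY = 1"
    using geo_inverse[of "1::int fps"] by simp
  have E: "(1 - Z * Y) * geo fps_X = 1"
    using geo_inverse[of "fps_X :: int fps"] by simp
  have "ladder 0 = IY * IZ * (IY - IZ)"
    by (simp add: ladder_def)
  then show ?thesis
    using kernel_identity[OF Y Z D E binom_gf_eq] by (simp add: total_gf_def D_def)
qed

text \<open>Multiplying by \<open>(y*z)^i\<close> moves all terms to the diagonal place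
  \<open>n - 1\<close>. As \<open>ladder i\<close> is \<open>(IY + IZ)^i * ladder 0\<close>, this
  leaves a geometric sum in \<open>q\<close>, and \<open>total_gf\<close> is its limit.\<close>

lemma sum_diagonal_ladder:
  assumes "n > 0"
  shows "(\<Sum>i<n. (fps_X ^ 2 * geo 2 * ladder i $ (n - 1 - i)) $ (n - 1 - i))
       = (Z ^ 2 * total_gf) $ (n - 1) $ (n - 1)"
proof -
  define q where "q = Y * Z * (IY + IZ)"
  have "(fps_X ^ 2 * geo 2 * ladder i $ (n - 1 - i)) $ (n - 1 - i)
      = (Z ^ 2 * fps_const (geo 2) * (q ^ i * ladder 0)) $ (n - 1) $ (n - 1)" if "i < n" for i
  proof -
    have "Z ^ 2 * fps_const (geo 2) * (q ^ i * ladder 0)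
        = Y ^ i * (fps_const (fps_X ^ i * (fps_X ^ 2 * geo 2)) * ladder i)"
      by (simp add: q_def ladder_def power_mult_distrib fps_const_power mult_ac
          flip: fps_const_mult)
    then show ?thesis
      using that by (simp add: fps_X_power_mult_nth mult.assoc)
  qed
  then have "(\<Sum>i<n. (fps_X ^ 2 * geo 2 * ladder i $ (n - 1 - i)) $ (n - 1 - i))
      = (\<Sum>i<n. Z ^ 2 * fps_const (geo 2) * (q ^ i * ladder 0)) $ (n - 1) $ (n - 1)"
    by (simp add: fps_sum_nth)
  also have "(\<Sum>i<n. Z ^ 2 * fps_const (geo 2) * (q ^ i * ladder 0))
      = Z ^ 2 * (fps_const (geo 2) * ladder 0) * (\<Sum>i<n. q ^ i)"
    by (simp only: sum_distrib_left) (simp only: mult_ac)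
  also have "\<dots> = Z ^ 2 * total_gf * ((1 - q) * (\<Sum>i<n. q ^ i))"
    unfolding total_gf_eq[folded q_def] by (simp only: mult.assoc)
  also have "(1 - q) * (\<Sum>i<n. q ^ i) = 1 - q ^ n"
    by (rule one_diff_power_eq[symmetric])
  \<comment> \<open>The remainder is a multiple of \<open>Y ^ n\<close>, hence invisible at
    \<open>y^(n-1)\<close>.\<close>
  also have "Z ^ 2 * total_gf * (1 - q ^ n)
      = Z ^ 2 * total_gf - Y ^ n * (Z ^ n * (IY + IZ) ^ n * Z ^ 2 * total_gf)"
  proof -
    have "q ^ n = Y ^ n * (Z ^ n * (IY + IZ) ^ n)"
      by (simp only: q_def power_mult_distrib mult.assoc)
    then show ?thesis
      by (simp only: right_diff_distrib mult_1_right) (simp only: mult_ac)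
  qed
  also have "\<dots> $ (n - 1) = (Z ^ 2 * total_gf) $ (n - 1)"
    using assms by (simp only: fps_sub_nth fps_X_power_mult_nth) simp
  finally show ?thesis .
qed

lemma geo_1_mult_geo_2_nth: "(geo 1 * geo 2 :: int fps) $ n = 2 ^ Suc n - 1"
  by (induction n) (simp_all add: geo_1_mult_nth)

lemma geo_X_mult_nth:
  fixes f :: "int fps fps"
  shows "(geo fps_X * f) $ M $ m = (\<Sum>k\<le>M. if m < k then 0 else f $ (M - k) $ (m - k))"
proof -
  have "(geo fps_X * f) $ M = (\<Sum>k\<le>M. fps_X ^ k * f $ (M - k))"
    by (simp add: fps_mult_nth atLeast0AtMost)
  then show ?thesis
    by (simp add: fps_sum_nth fps_X_power_mult_nth)
qed

text \<open>Multiplication by \<open>geo fps_X\<close>, the sum of all \<open>(y*z)^k\<close>, takes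
  partial sums along the diagonal.\<close>

lemma Z2_total_gf_nth:
  "(Z ^ 2 * total_gf) $ N $ N = (\<Sum>i = 1..N. int ((2 * i) choose (i - 1)) - 2 ^ (i - 1))"
proof -
  define f where "f = Z ^ 2 * (binom_gf - IY * IZ * fps_const (geo 2))"
  have f: "f $ k $ k = (if k = 0 then 0 else int ((2 * k) choose (k - 1)) - 2 ^ (k - 1))" for k
  proof -
    have "IY * IZ * fps_const (geo 2) = IY * fps_const (geo 1 * geo 2)"
      by (simp add: mult.assoc flip: fps_const_mult)
    then have g: "(IY * IZ * fps_const (geo 2)) $ k = geo 1 * geo 2"
      by simp
    have f_nth: "f $ k $ k = (fps_X ^ 2 * (binom_gf $ k - geo 1 * geo 2)) $ k"
      by (simp add: f_def g fps_const_power)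
    show ?thesis
    proof (cases "k < 2")
      case True
      then have "k = 0 \<or> k = 1" by auto
      \<comment> \<open>At \<open>k = 1\<close> the factor \<open>Z ^ 2\<close> gives 0, in
        accordance with \<open>1 - 1\<close> in the formula.\<close>
      then show ?thesis using f_nth by (auto simp: fps_X_power_mult_nth)
    next
      case False
      define j where "j = k - 2"
      have k: "k - 1 = Suc j" "2 * k = k + j + 2" "2 * k - (k - 1) = k + 1"
        using False by (auto simp: j_def)
      have "(2 * k) choose (k - 1) = (2 * k) choose (2 * k - (k - 1))"
        by (rule binomial_symmetric) simp
      also have "\<dots> = (k + j + 2) choose (k + 1)"
        by (simp only: k(3)) (simp only: k(2))
      finally have choose: "(2 * k) choose (k - 1) = (k + j + 2) choose (k + 1)" .
      have "f $ k $ k = (binom_gf $ k - geo 1 * geo 2) $ j"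
        using f_nth False by (simp add: fps_X_power_mult_nth j_def)
      \<comment> \<open>The 1 subtracted in \<open>binom_gf\<close> cancels against that in
        \<open>2 ^ Suc j - 1\<close>.\<close>
      also have "\<dots> = int ((k + j + 2) choose (k + 1)) - 2 ^ Suc j"
        unfolding fps_sub_nth geo_1_mult_geo_2_nth by (simp add: binom_gf_def del: binomial_Suc_Suc)
      finally show ?thesis
        using False choose k(1) by (simp del: binomial_Suc_Suc)
    qed
  qed
  have "Z ^ 2 * total_gf = geo fps_X * f"
    by (simp add: total_gf_def f_def mult_ac)
  then have "(Z ^ 2 * total_gf) $ N $ N = (\<Sum>k\<le>N. f $ (N - k) $ (N - k))"
    by (simp add: geo_X_mult_nth)
  also have "\<dots> = (\<Sum>k\<le>N. f $ k $ k)"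
    using sum.nat_diff_reindex[of "\<lambda>k. f $ k $ k" "Suc N"] by (simp add: lessThan_Suc_atMost)
  also have "\<dots> = (\<Sum>k\<in>{1..N}. f $ k $ k)"
    by (rule sum.mono_neutral_right) (auto simp: f)
  finally show ?thesis
    by (simp add: f)
qed

theorem theorem1p2:
  fixes n :: nat
  assumes "n \<ge> 1"
  shows "card (avoiding_inversion_sequences n [0, 0, 1, 2]) =
           1 + (\<Sum>i = 1..n - 1. (2 * i) choose (i - 1))"
proof -
  obtain N where n: "n = Suc N"
    using assms by (cases n) auto
  \<comment> \<open>This is the contribution of sequences with a repetition but no ascent from there
    on; written as a sum, it cancels the powers of 2 on the diagonal.\<close>
  have pow: "(fps_X ^ 2 * geo 2 * geo 1 :: int fps) $ n = (\<Sum>i = 1..N. 2 ^ (i - 1))"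
  proof -
    have "(fps_X ^ 2 * geo 2 * geo 1 :: int fps) $ n = (fps_X ^ 2 * (geo 1 * geo 2)) $ n"
      by (simp only: mult_ac)
    also have "\<dots> = 2 ^ N - 1"
      by (cases N) (simp_all add: n fps_X_power_mult_nth geo_1_mult_geo_2_nth)
    also have "\<dots> = (\<Sum>i = 1..N. 2 ^ (i - 1))"
      by (induction N) auto
    finally show ?thesis .
  qed
  have "int (staircase_count n 0) = 1 + (\<Sum>i = 1..N. 2 ^ (i - 1))
      + (\<Sum>i = 1..N. int ((2 * i) choose (i - 1)) - 2 ^ (i - 1))"
    using staircase_count_gf[of n] sum_diagonal_ladder[of n] Z2_total_gf_nth[of N] pow n by simp
  also have "\<dots> = int (1 + (\<Sum>i = 1..n - 1. (2 * i) choose (i - 1)))"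
    by (simp add: sum_subtractf n)
  finally show ?thesis
    by (simp only: card_avoiding_0012 of_nat_eq_iff)
qed

end
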